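(* Let $C\subset\mathbb{R}^n$ be a nonempty, open and convex set and let $H\in\mathcal{C}^1(C;\mathbb{S}^n_{++})$, so that $(u,v)^H_x=\langle H(x)u,v\rangle$ ($x\in C$, $u,v\in\mathbb{R}^n$) is a $\mathcal{C}^1$ Riemannian metric on $C$. For $y\in C$ let $V^y:C\to\mathbb{R}^n$ be the vector field $V^y(x)=x-y$. Then every $V^y$, $y\in C$, is a $(\cdot,\cdot)^H$-gradient vector field if and only if there exists a strictly convex function $h\in\mathcal{C}^3(C)$ such that $H(x)=\nabla^2h(x)$ for all $x\in C$. Moreover, in that case, defining $D_h:C\times C\to\mathbb{R}$ by $$D_h(y,x)=h(y)-h(x)-\langle\nabla h(x),y-x\rangle,$$ one has $\nabla_H D_h(y,\cdot)(x)=x-y$ for all $x,y\in C$.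
   Context: $\langle\cdot,\cdot\rangle$ is the Euclidean scalar product of $\mathbb{R}^n$, $\nabla$ and $\nabla^2$ are the Euclidean gradient and Hessian, and $\mathbb{S}^n_{++}$ is the cone of real symmetric positive definite $n\times n$ matrices. For a $\mathcal{C}^1$ function $\varphi:C\to\mathbb{R}$, its gradient with respect to the metric $(\cdot,\cdot)^H$ is $\nabla_H\varphi(x)=H(x)^{-1}\nabla\varphi(x)$. A vector field $V$ on $C$ is a $(\cdot,\cdot)^H$-gradient vector field if $V=\nabla_H\varphi$ on $C$ for some $\varphi\in\mathcal{C}^1(C;\mathbb{R})$. *)

theory Defs
  imports "HOL-Analysis.Analysis"
begin

text \<open>
  Functions on an open set \<open>C\<close> are represented by total functions; the notions below depend
  only on their values on \<open>C\<close> when \<open>C\<close> is open and they are evaluated at points of \<open>C\<close>.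
\<close>

text \<open>
  \<open>k\<close>-fold continuous differentiability on an open set. For \<open>b \<in> Basis\<close> the function
  \<open>\<lambda>x. frechet_derivative f (at x) b\<close> is the partial derivative of \<open>f\<close> along \<open>b\<close>.
\<close>

fun Ck_on :: "nat \<Rightarrow> ('a::euclidean_space \<Rightarrow> 'b::real_normed_vector) \<Rightarrow> 'a set \<Rightarrow> bool" where
  "Ck_on 0 f S \<longleftrightarrow> continuous_on S f"
| "Ck_on (Suc k) f S \<longleftrightarrow>
     (\<forall>x\<in>S. f differentiable (at x)) \<and>
     (\<forall>b\<in>Basis. Ck_on k (\<lambda>x. frechet_derivative f (at x) b) S)"

definition strictly_convex_on :: "'a::real_vector set \<Rightarrow> ('a \<Rightarrow> real) \<Rightarrow> bool" where
  "strictly_convex_on S f \<longleftrightarrow>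
     convex S \<and>
     (\<forall>x\<in>S. \<forall>y\<in>S. \<forall>t. x \<noteq> y \<longrightarrow> 0 < t \<longrightarrow> t < 1 \<longrightarrow>
        f ((1 - t) *\<^sub>R x + t *\<^sub>R y) < (1 - t) * f x + t * f y)"

definition sym_pos_def :: "(real^'n^'n) set" where
  "sym_pos_def = {A. transpose A = A \<and> (\<forall>v. v \<noteq> 0 \<longrightarrow> 0 < (A *v v) \<bullet> v)}"

definition grad :: "('a::real_inner \<Rightarrow> real) \<Rightarrow> 'a \<Rightarrow> 'a" where
  "grad f x = (THE D. GDERIV f x :> D)"

definition hessian :: "(real^'n \<Rightarrow> real) \<Rightarrow> real^'n \<Rightarrow> real^'n^'n" where
  "hessian f x = jacobian (grad f) (at x)"

lemma grad_eqI: "grad f x = D" if "GDERIV f x :> D"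
  unfolding grad_def
proof (rule the_equality)
  show "GDERIV f x :> D" by fact
  fix D' assume "GDERIV f x :> D'"
  with that have "(\<lambda>v. v \<bullet> D') = (\<lambda>v. v \<bullet> D)"
    unfolding gderiv_def by (metis has_derivative_unique)
  then show "D' = D"
    by (simp add: fun_eq_iff vector_eq_ldot)
qed

text \<open>Gradient with respect to the Riemannian metric \<open>(u, v) \<mapsto> (H x *v u) \<bullet> v\<close>.\<close>

definition metric_grad ::
    "(real^'n \<Rightarrow> real^'n^'n) \<Rightarrow> (real^'n \<Rightarrow> real) \<Rightarrow> real^'n \<Rightarrow> real^'n" where
  "metric_grad H f x = matrix_inv (H x) *v grad f x"

definition metric_gradient_field_on ::
    "(real^'n) set \<Rightarrow> (real^'n \<Rightarrow> real^'n^'n) \<Rightarrow> (real^'n \<Rightarrow> real^'n) \<Rightarrow> bool" where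
  "metric_gradient_field_on C H V \<longleftrightarrow>
     (\<exists>\<phi>. Ck_on 1 \<phi> C \<and> (\<forall>x\<in>C. V x = metric_grad H \<phi> x))"

definition bregman :: "('a::real_inner \<Rightarrow> real) \<Rightarrow> 'a \<Rightarrow> 'a \<Rightarrow> real" where
  "bregman h y x = h y - h x - grad h x \<bullet> (y - x)"

end

theory Submission
  imports Defs
begin

text \<open>
  If every \<open>V\<^sup>y\<close> is the \<open>H\<close>-gradient of some \<open>\<phi> y\<close>, then \<open>\<nabla>(\<phi> y)(x) = H(x)(x - y)\<close>, so
  \<open>\<phi> z - \<phi> y\<close> has the Euclidean gradient \<open>H(x)(y - z)\<close>. As \<open>C\<close> is open, \<open>y - z\<close> can be a small
  multiple of any basis vector \<open>b\<close>; hence every \<open>x \<mapsto> H(x) b\<close> is the gradient of a function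
  \<open>g b\<close>. Since \<open>H\<close> is symmetric, the field \<open>g\<close> with these components has the derivative \<open>H\<close>, and by
  the product rule \<open>h(x) = \<langle>g(x), x - y\<rangle> - \<phi> y (x)\<close> has the gradient \<open>g\<close>; no integration
  (Poincare lemma) is needed. Conversely, differentiating the Bregman distance gives
  \<open>\<nabla>(D\<^sub>h(y, \<cdot>))(x) = \<nabla>\<^sup>2h(x)(x - y)\<close>.
\<close>

section \<open>Calculus of \<open>Ck_on\<close>\<close>

lemma Ck_on_cong:
  assumes "open S" "\<And>x. x \<in> S \<Longrightarrow> f x = g x" "Ck_on k f S"
  shows "Ck_on k g S"
  using assms(2,3)
proof (induction k arbitrary: f g)
  case 0
  then show ?case by (simp cong: continuous_on_cong)
next
  case (Suc k)
  have d: "f differentiable (at x)" if "x \<in> S" for x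
    using Suc.prems that by simp
  have "g differentiable (at x)" if "x \<in> S" for x
    using has_derivative_transform_within_open[of f _ x UNIV S g] assms(1) Suc.prems(1) d[OF that] that
    unfolding differentiable_def by blast
  moreover have "Ck_on k (\<lambda>x. frechet_derivative g (at x) b) S" if "b \<in> Basis" for b
  proof (rule Suc.IH)
    show "Ck_on k (\<lambda>x. frechet_derivative f (at x) b) S"
      using Suc.prems that by simp
    show "frechet_derivative f (at x) b = frechet_derivative g (at x) b" if "x \<in> S" for x
      using frechet_derivative_transform_within_open[OF d[OF that] assms(1) that Suc.prems(1)]
      by simp
  qed
  ultimately show ?case by simp
qed

text \<open>Allows an explicit formula \<open>f'\<close> in place of
  \<open>frechet_derivative\<close> in the recursion of \<open>Ck_on\<close>. The two agree only on
  \<open>S\<close>, hence the appeal to \<open>Ck_on_cong\<close>.\<close>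

lemma Ck_on_SucI:
  assumes "open S" "\<And>x. x \<in> S \<Longrightarrow> (f has_derivative f' x) (at x)"
    and "\<And>b. b \<in> Basis \<Longrightarrow> Ck_on k (\<lambda>x. f' x b) S"
  shows "Ck_on (Suc k) f S"
proof -
  have "Ck_on k (\<lambda>x. frechet_derivative f (at x) b) S" if "b \<in> Basis" for b
    by (rule Ck_on_cong[OF assms(1) _ assms(3)[OF that]])
      (simp add: frechet_derivative_at[OF assms(2), symmetric])
  with assms(2) show ?thesis
    by (auto simp: differentiable_def)
qed

lemma Ck_on_bounded_linear:
  assumes "open S" "bounded_linear L" "Ck_on k f S"
  shows "Ck_on k (\<lambda>x. L (f x)) S"
  using assms(3)
proof (induction k arbitrary: f)
  case 0
  then show ?case
    by (simp add: bounded_linear.continuous_on[OF assms(2)])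
next
  case (Suc k)
  show ?case
  proof (rule Ck_on_SucI[OF assms(1)])
    show "((\<lambda>x. L (f x)) has_derivative (\<lambda>v. L (frechet_derivative f (at x) v))) (at x)"
      if "x \<in> S" for x
      using Suc.prems that
      by (intro bounded_linear.has_derivative[OF assms(2)]) (simp add: frechet_derivative_works)
  qed (use Suc in auto)
qed

lemma Ck_on_1_imp_continuous_on:
  assumes "Ck_on 1 f S"
  shows "continuous_on S f"
  using assms by (auto intro!: continuous_at_imp_continuous_on differentiable_imp_continuous_within)

lemma bounded_linear_matrix_vector_mult_left:
  "bounded_linear (\<lambda>A::real^'n^'m. A *v v)"
  by (intro linear_conv_bounded_linear[THEN iffD1] linearI)
    (simp_all add: matrix_vector_mult_add_rdistrib scaleR_matrix_vector_assoc)

section \<open>Gradients and positive definite matrices\<close>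

text \<open>Riesz representation in coordinates: the vector of partial derivatives represents the
  derivative, so the \<open>THE\<close> in \<open>grad\<close> denotes it.\<close>

lemma GDERIV_grad:
  fixes f :: "'a::euclidean_space \<Rightarrow> real"
  assumes "f differentiable (at x)"
  shows "GDERIV f x :> grad f x"
proof -
  let ?D = "frechet_derivative f (at x)"
  have D: "(f has_derivative ?D) (at x)"
    using assms by (simp add: frechet_derivative_works)
  have "?D v = v \<bullet> (\<Sum>b\<in>Basis. ?D b *\<^sub>R b)" for v
  proof -
    have lin: "linear ?D"
      using D by (rule has_derivative_linear)
    have "?D v = ?D (\<Sum>b\<in>Basis. (v \<bullet> b) *\<^sub>R b)"
      by (simp only: euclidean_representation)
    also have "\<dots> = (\<Sum>b\<in>Basis. (v \<bullet> b) * ?D b)"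
      by (simp add: linear_sum[OF lin] linear_cmul[OF lin])
    finally show ?thesis
      by (simp add: inner_sum_right mult.commute)
  qed
  then have "GDERIV f x :> (\<Sum>b\<in>Basis. ?D b *\<^sub>R b)"
    using D unfolding gderiv_def by (metis (no_types, lifting) ext)
  then show ?thesis
    using grad_eqI by metis
qed

lemma sym_pos_def_inner:
  assumes "A \<in> sym_pos_def"
  shows "(A *v u) \<bullet> v = u \<bullet> (A *v v)"
  using assms unfolding sym_pos_def_def
  by (metis (mono_tags, lifting) dot_lmul_matrix mem_Collect_eq transpose_matrix_vector)

text \<open>The kernel is trivial: if \<open>A *v v = 0\<close>, then
  \<open>(A *v v) \<bullet> v = 0\<close>, so \<open>v = 0\<close>. A left inverse of a square
  matrix is two-sided, which makes the \<open>SOME\<close> in \<open>matrix_inv\<close>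
  meaningful.\<close>

lemma sym_pos_def_matrix_inv:
  fixes A :: "real^'n^'n"
  assumes "A \<in> sym_pos_def"
  shows "A ** matrix_inv A = mat 1" "matrix_inv A ** A = mat 1"
proof -
  have "\<exists>B. B ** A = mat 1"
    unfolding matrix_left_invertible_ker
    using assms by (force simp: sym_pos_def_def)
  then have "\<exists>B. A ** B = mat 1 \<and> B ** A = mat 1"
    using matrix_left_right_inverse by blast
  then have "A ** matrix_inv A = mat 1 \<and> matrix_inv A ** A = mat 1"
    unfolding matrix_inv_def by (rule someI_ex)
  then show "A ** matrix_inv A = mat 1" "matrix_inv A ** A = mat 1" by auto
qed

text \<open>Turns statements about the metric gradient into Euclidean ones free of matrix
  inverses.\<close>

lemma metric_grad_eq_iff:
  assumes "H x \<in> sym_pos_def"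
  shows "metric_grad H f x = v \<longleftrightarrow> grad f x = H x *v v"
  unfolding metric_grad_def
  using sym_pos_def_matrix_inv[OF assms] by (metis matrix_vector_mul_assoc matrix_vector_mul_lid)

section \<open>Strict convexity from a positive definite second derivative\<close>

text \<open>Restrict to the segment \<open>p\<close> from \<open>x\<close> to \<open>y\<close>.
  Positivity of \<open>g'\<close> makes the slope of \<open>f\<close> along \<open>p\<close>
  strictly increasing, so \<open>F\<close>, which is \<open>f\<close> along \<open>p\<close> minus
  the linear term of the tangent at \<open>x\<close>, increases.\<close>

lemma first_order_strict:
  fixes f :: "'a::real_inner \<Rightarrow> real"
  assumes "convex S"
    and f: "\<And>z. z \<in> S \<Longrightarrow> GDERIV f z :> g z"
    and g: "\<And>z. z \<in> S \<Longrightarrow> (g has_derivative g' z) (at z)"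
    and pos: "\<And>z v. z \<in> S \<Longrightarrow> v \<noteq> 0 \<Longrightarrow> 0 < g' z v \<bullet> v"
    and "x \<in> S" "y \<in> S" "x \<noteq> y"
  shows "f x + g x \<bullet> (y - x) < f y"
proof -
  define p where "p t = x + t *\<^sub>R (y - x)" for t
  define F where "F t = f (p t) - t * (g x \<bullet> (y - x))" for t
  have pS: "p t \<in> S" if "0 \<le> t" "t \<le> 1" for t
    using convexD_alt[OF \<open>convex S\<close> \<open>x \<in> S\<close> \<open>y \<in> S\<close> that] by (simp add: p_def algebra_simps)
  have p: "(p has_derivative (\<lambda>s. s *\<^sub>R (y - x))) (at t)" for t
    unfolding p_def by (auto intro!: derivative_eq_intros)
  have G: "((\<lambda>t. g (p t) \<bullet> (y - x)) has_real_derivative g' (p t) (y - x) \<bullet> (y - x)) (at t)"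
    if "0 \<le> t" "t \<le> 1" for t
  proof -
    note g' = g[OF pS[OF that]]
    have "((\<lambda>t. g (p t)) has_derivative (\<lambda>s. g' (p t) (s *\<^sub>R (y - x)))) (at t)"
      using diff_chain_at[OF p, of g "g' (p t)" t] g' by (simp add: o_def)
    then have "((\<lambda>t. g (p t) \<bullet> (y - x)) has_derivative (\<lambda>s. g' (p t) (s *\<^sub>R (y - x)) \<bullet> (y - x))) (at t)"
      by (rule has_derivative_inner_left)
    then show ?thesis
      by (simp add: has_field_derivative_def linear_cmul[OF has_derivative_linear[OF g']] mult.commute[of _ "_ \<bullet> _"])
  qed
  have F: "(F has_real_derivative (g (p t) \<bullet> (y - x) - g x \<bullet> (y - x))) (at t)"
    if "0 \<le> t" "t \<le> 1" for t
  proof -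
    have "((\<lambda>t. f (p t)) has_derivative (\<lambda>s. (s *\<^sub>R (y - x)) \<bullet> g (p t))) (at t)"
      using diff_chain_at[OF p, of f "\<lambda>v. v \<bullet> g (p t)" t] f[OF pS[OF that]] by (simp add: o_def gderiv_def)
    then have "((\<lambda>t. f (p t)) has_real_derivative g (p t) \<bullet> (y - x)) (at t)"
      by (simp add: has_field_derivative_def inner_commute mult.commute[of _ "_ \<bullet> _"])
    then show ?thesis
      unfolding F_def by (auto intro!: derivative_eq_intros)
  qed
  have "F 0 < F 1"
  \<comment> \<open>The derivative of \<open>F\<close> vanishes at 0, so positivity is asked only
    inside the interval and continuity covers the ends.\<close>
  proof (rule DERIV_pos_imp_increasing_open[of 0 1 F])
    show "continuous_on {0..1} F"
      using F by (auto intro!: continuous_at_imp_continuous_on DERIV_isCont)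
    fix t :: real
    assume t: "0 < t" "t < 1"
    have "g (p 0) \<bullet> (y - x) < g (p t) \<bullet> (y - x)"
    proof (rule DERIV_pos_imp_increasing[OF t(1)])
      fix s assume "0 \<le> s" "s \<le> t"
      with t have s: "0 \<le> s" "s \<le> 1" by auto
      show "\<exists>d. ((\<lambda>t. g (p t) \<bullet> (y - x)) has_real_derivative d) (at s) \<and> 0 < d"
        using G[OF s] pos[OF pS[OF s], of "y - x"] \<open>x \<noteq> y\<close> by auto
    qed
    then show "\<exists>d. (F has_real_derivative d) (at t) \<and> 0 < d"
      using F[of t] t by (auto simp: p_def)
  qed simp
  then show ?thesis by (simp add: F_def p_def)
qed

text \<open>Average the tangent inequalities at the intermediate point \<open>z\<close> with weights
  \<open>1 - t\<close> and \<open>t\<close>. The linear terms cancel because \<open>z\<close> is the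
  same average of \<open>x\<close> and \<open>y\<close>.\<close>

lemma strictly_convex_onI:
  fixes f :: "'a::real_inner \<Rightarrow> real"
  assumes "convex S"
    and less: "\<And>x y. x \<in> S \<Longrightarrow> y \<in> S \<Longrightarrow> x \<noteq> y \<Longrightarrow> f x + g x \<bullet> (y - x) < f y"
  shows "strictly_convex_on S f"
  unfolding strictly_convex_on_def
proof (intro conjI ballI allI impI)
  fix x y and t :: real
  assume xy: "x \<in> S" "y \<in> S" "x \<noteq> y" and t: "0 < t" "t < 1"
  define z where "z = (1 - t) *\<^sub>R x + t *\<^sub>R y"
  have z: "z \<in> S"
    using convexD_alt[OF \<open>convex S\<close>, of x y t] xy t by (simp add: z_def)
  have zx: "x - z = t *\<^sub>R (x - y)" and zy: "y - z = (1 - t) *\<^sub>R (y - x)"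
    by (simp_all add: z_def algebra_simps)
  have "z \<noteq> x" "z \<noteq> y"
    using zx zy xy t by auto
  then have "f z + g z \<bullet> (x - z) < f x" "f z + g z \<bullet> (y - z) < f y"
    using less z xy by auto
  then have "(1 - t) * (f z + t * (g z \<bullet> (x - y))) + t * (f z + (1 - t) * (g z \<bullet> (y - x)))
      < (1 - t) * f x + t * f y"
    using t by (intro add_strict_mono mult_strict_left_mono) (simp_all add: zx zy)
  moreover have "g z \<bullet> (y - x) = - (g z \<bullet> (x - y))"
    by (simp add: inner_diff_right)
  ultimately show "f ((1 - t) *\<^sub>R x + t *\<^sub>R y) < (1 - t) * f x + t * f y"
    unfolding z_def[symmetric] by (simp add: algebra_simps)
qed (rule assms(1))

section \<open>From gradient fields to a potential\<close>

lemma gradient_fields_imp_potential: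
  fixes C :: "(real^'n) set"
  assumes "C \<noteq> {}" "open C"
    and spd: "\<And>x. x \<in> C \<Longrightarrow> H x \<in> sym_pos_def"
    and fields: "\<forall>y\<in>C. metric_gradient_field_on C H (\<lambda>x. x - y)"
  obtains h g where "\<And>x. x \<in> C \<Longrightarrow> GDERIV h x :> g x"
    and "\<And>x. x \<in> C \<Longrightarrow> (g has_derivative (*v) (H x)) (at x)"
proof -
  have "\<exists>\<phi>. \<forall>x\<in>C. GDERIV \<phi> x :> H x *v (x - y)" if y: "y \<in> C" for y
  proof -
    obtain \<phi> where \<phi>: "Ck_on 1 \<phi> C" "\<forall>x\<in>C. x - y = metric_grad H \<phi> x"
      using fields y unfolding metric_gradient_field_on_def by blast
    have "GDERIV \<phi> x :> H x *v (x - y)" if "x \<in> C" for x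
    proof -
      have "grad \<phi> x = H x *v (x - y)"
        using \<phi>(2) that metric_grad_eq_iff[of H x \<phi> "x - y"] spd by auto
      then show ?thesis
        using GDERIV_grad[of \<phi> x] \<phi>(1) that by simp
    qed
    then show ?thesis by blast
  qed
  then obtain \<phi> where \<phi>: "\<And>x y. x \<in> C \<Longrightarrow> y \<in> C \<Longrightarrow> GDERIV (\<phi> y) x :> H x *v (x - y)"
    by (metis (no_types))
  obtain y where y: "y \<in> C" using assms(1) by blast
  \<comment> \<open>Basis vectors have norm 1, so this single \<open>e\<close> puts
    \<open>y - e *\<^sub>R b\<close> into \<open>C\<close> for every \<open>b\<close>.\<close>
  obtain e where e: "0 < e" "cball y e \<subseteq> C"
    using assms(2) y open_contains_cball by blast
  \<comment> \<open>The difference has gradient \<open>H x *v (e *\<^sub>R b)\<close>; dividing by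
    \<open>e\<close> leaves \<open>H x *v b\<close>.\<close>
  define \<psi> where "\<psi> b = (\<lambda>x. (\<phi> (y - e *\<^sub>R b) x - \<phi> y x) / e)" for b
  define g where "g = (\<lambda>x. \<Sum>b\<in>Basis. \<psi> b x *\<^sub>R b)"
  define h where "h = (\<lambda>x. g x \<bullet> (x - y) - \<phi> y x)"
  have \<psi>: "(\<psi> b has_derivative (\<lambda>v. v \<bullet> (H x *v b))) (at x)" if "x \<in> C" "b \<in> Basis" for x b
  proof -
    have "y - e *\<^sub>R b \<in> C"
      using e that by (auto simp: dist_norm subset_iff)
    then have "((\<lambda>x. \<phi> (y - e *\<^sub>R b) x - \<phi> y x) has_derivative
        (\<lambda>v. v \<bullet> (H x *v (x - (y - e *\<^sub>R b))) - v \<bullet> (H x *v (x - y)))) (at x)"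
      using \<phi>[OF that(1)] y unfolding gderiv_def by (intro has_derivative_diff) auto
    from has_derivative_mult_right[OF this, of "1 / e"] show ?thesis
      using e(1) by (simp add: \<psi>_def matrix_vector_mult_diff_distrib matrix_vector_mult_scaleR
          matrix_vector_right_distrib inner_diff_right inner_add_right)
  qed
  have g: "(g has_derivative (*v) (H x)) (at x)" if "x \<in> C" for x
  proof -
    have "(g has_derivative (\<lambda>v. \<Sum>b\<in>Basis. (v \<bullet> (H x *v b)) *\<^sub>R b)) (at x)"
      unfolding g_def using \<psi>[OF that]
      by (intro has_derivative_sum has_derivative_scaleR_left) auto
    also have "(\<lambda>v. \<Sum>b\<in>Basis. (v \<bullet> (H x *v b)) *\<^sub>R b) = (*v) (H x)"
      by (simp add: fun_eq_iff sym_pos_def_inner[OF spd[OF that], symmetric] euclidean_representation)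
    finally show ?thesis .
  qed
  have "GDERIV h x :> g x" if "x \<in> C" for x
  proof -
    \<comment> \<open>The last two terms cancel by symmetry of \<open>H x\<close>; subtracting
      \<open>\<phi> y\<close> in \<open>h\<close> serves this purpose.\<close>
    have "(h has_derivative (\<lambda>v. g x \<bullet> v + (H x *v v) \<bullet> (x - y) - v \<bullet> (H x *v (x - y)))) (at x)"
      unfolding h_def using \<phi>[OF that y] g[OF that] unfolding gderiv_def
      by (intro has_derivative_diff has_derivative_inner) (auto intro!: derivative_eq_intros)
    then show ?thesis
      by (simp add: gderiv_def sym_pos_def_inner[OF spd[OF that]] inner_commute[of "g x"])
  qed
  with g show ?thesis using that by blast
qed

text \<open>The regularity of \<open>h\<close> is read off from \<open>H\<close>: the successive
  derivatives of \<open>h\<close> are given by \<open>g\<close> and \<open>H\<close>, and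
  \<open>H\<close> contributes the third order of differentiability.\<close>

lemma potential_imp_hessian:
  fixes C :: "(real^'n) set"
  assumes "open C" "convex C" "Ck_on 1 H C"
    and spd: "\<And>x. x \<in> C \<Longrightarrow> H x \<in> sym_pos_def"
    and h: "\<And>x. x \<in> C \<Longrightarrow> GDERIV h x :> g x"
    and g: "\<And>x. x \<in> C \<Longrightarrow> (g has_derivative (*v) (H x)) (at x)"
  shows "strictly_convex_on C h \<and> Ck_on 3 h C \<and> (\<forall>x\<in>C. H x = hessian h x)"
proof (intro conjI ballI)
  show "strictly_convex_on C h"
  proof (rule strictly_convex_onI[OF assms(2)])
    show "h x + g x \<bullet> (y - x) < h y" if "x \<in> C" "y \<in> C" "x \<noteq> y" for x y
      by (rule first_order_strict[OF assms(2) h g _ that])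
        (use spd in \<open>auto simp: sym_pos_def_def\<close>)
  qed
  show "Ck_on 3 h C"
    unfolding numeral_3_eq_3
  proof (rule Ck_on_SucI[OF assms(1)])
    show "(h has_derivative (\<lambda>v. v \<bullet> g x)) (at x)" if "x \<in> C" for x
      using h[OF that] by (simp add: gderiv_def)
    show "Ck_on (Suc (Suc 0)) (\<lambda>x. b \<bullet> g x) C" for b
    proof (rule Ck_on_SucI[OF assms(1)])
      show "((\<lambda>x. b \<bullet> g x) has_derivative (\<lambda>v. b \<bullet> (H x *v v))) (at x)" if "x \<in> C" for x
        using g[OF that] by (rule has_derivative_inner_right)
      \<comment> \<open>This is a fixed linear functional of the matrix \<open>H x\<close>.\<close>
      show "Ck_on (Suc 0) (\<lambda>x. b \<bullet> (H x *v v)) C" for v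
        using assms(3) bounded_linear_compose[OF bounded_linear_inner_right
            bounded_linear_matrix_vector_mult_left]
        by (intro Ck_on_bounded_linear[OF assms(1), where L = "\<lambda>A. b \<bullet> (A *v v)"]) auto
    qed
  qed
  fix x assume x: "x \<in> C"
  \<comment> \<open>\<open>grad h\<close> and \<open>g\<close> are known to agree only on
    \<open>C\<close>; since \<open>C\<close> is open, the derivative carries over.\<close>
  have "(grad h has_derivative (*v) (H x)) (at x)"
    by (rule has_derivative_transform_within_open[OF g[OF x] assms(1) x])
      (simp add: grad_eqI[OF h])
  then show "H x = hessian h x"
    unfolding hessian_def jacobian_def
    by (simp add: frechet_derivative_at[symmetric])
qed

section \<open>Hessian and Bregman distance\<close>

text \<open>Bridges two encodings: \<open>Ck_on\<close> speaks of partial derivatives,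
  \<open>hessian\<close> of the Jacobian of \<open>grad\<close>. The vector of partial derivatives
  is differentiable and coincides with \<open>grad h\<close> on the open set
  \<open>C\<close>.\<close>

lemma grad_has_derivative_hessian:
  fixes h :: "real^'n \<Rightarrow> real"
  assumes "open C" "Ck_on (Suc (Suc k)) h C" "x \<in> C"
  shows "(grad h has_derivative (*v) (hessian h x)) (at x)"
proof -
  let ?g = "\<lambda>x. \<Sum>b\<in>Basis. frechet_derivative h (at x) b *\<^sub>R b"
  have "?g differentiable (at x)"
    using assms by (intro differentiable_sum differentiable_scaleR) auto
  moreover have "?g z = grad h z" if "z \<in> C" for z
  proof -
    have "GDERIV h z :> grad h z"
      using assms that by (intro GDERIV_grad) simp
    then have "frechet_derivative h (at z) b = grad h z \<bullet> b" for b
      by (simp add: gderiv_def frechet_derivative_at[symmetric] inner_commute)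
    then show ?thesis by (simp add: euclidean_representation)
  qed
  ultimately have "grad h differentiable (at x)"
    using has_derivative_transform_within_open[OF _ assms(1,3), of ?g _ UNIV "grad h"]
    unfolding differentiable_def by blast
  then show ?thesis
    by (simp add: jacobian_works hessian_def)
qed

text \<open>In the derivative in \<open>x\<close>, the two terms with \<open>grad h x\<close>
  cancel, and symmetry of the Hessian moves it from \<open>v\<close> to
  \<open>x - y\<close>.\<close>

lemma GDERIV_bregman:
  fixes h :: "real^'n \<Rightarrow> real"
  assumes "open C" "Ck_on (Suc (Suc k)) h C" "x \<in> C" "hessian h x \<in> sym_pos_def"
  shows "GDERIV (bregman h y) x :> hessian h x *v (x - y)"
proof -
  have "GDERIV h x :> grad h x"
    using assms by (intro GDERIV_grad) simp
  then have "((\<lambda>x. h y - h x - grad h x \<bullet> (y - x)) has_derivative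
      (\<lambda>v. 0 - v \<bullet> grad h x - (grad h x \<bullet> (0 - v) + (hessian h x *v v) \<bullet> (y - x)))) (at x)"
    using grad_has_derivative_hessian[OF assms(1-3)] unfolding gderiv_def
    by (intro has_derivative_diff has_derivative_inner has_derivative_const has_derivative_ident)
  moreover have "0 - v \<bullet> grad h x - (grad h x \<bullet> (0 - v) + (hessian h x *v v) \<bullet> (y - x))
      = v \<bullet> (hessian h x *v (x - y))" for v
    by (simp add: sym_pos_def_inner[OF assms(4)] inner_commute[of "grad h x"]
        matrix_vector_mult_diff_distrib inner_diff_right)
  ultimately show ?thesis
    by (simp add: gderiv_def bregman_def[abs_def])
qed

theorem theorem3p1:
  fixes C :: "(real^'n) set" and H :: "real^'n \<Rightarrow> real^'n^'n"
  assumes "C \<noteq> {}" and "open C" and "convex C"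
    and "Ck_on 1 H C" and "\<And>x. x \<in> C \<Longrightarrow> H x \<in> sym_pos_def"
  shows "((\<forall>y\<in>C. metric_gradient_field_on C H (\<lambda>x. x - y)) \<longleftrightarrow>
            (\<exists>h. strictly_convex_on C h \<and> Ck_on 3 h C \<and> (\<forall>x\<in>C. H x = hessian h x)))
       \<and> (\<forall>h. strictly_convex_on C h \<and> Ck_on 3 h C \<and> (\<forall>x\<in>C. H x = hessian h x) \<longrightarrow>
            (\<forall>x\<in>C. \<forall>y\<in>C. metric_grad H (bregman h y) x = x - y))"
proof -
  have D: "GDERIV (bregman h y) x :> H x *v (x - y)"
    if "Ck_on 3 h C" "\<forall>x\<in>C. H x = hessian h x" "x \<in> C" for h x y
    using GDERIV_bregman[of C "Suc 0" h x y] that assms(2,5) by (simp add: numeral_3_eq_3)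
  have grad: "metric_grad H (bregman h y) x = x - y"
    if "Ck_on 3 h C" "\<forall>x\<in>C. H x = hessian h x" "x \<in> C" for h x y
    using grad_eqI[OF D[OF that]] metric_grad_eq_iff[of H x] assms(5)[OF that(3)] by auto
  \<comment> \<open>A gradient field requires a continuously differentiable potential. The
    derivative of \<open>bregman h y\<close> is expressed through \<open>H\<close>, whose continuity
    gives that of the partial derivatives.\<close>
  have C1: "Ck_on 1 (bregman h y) C"
    if h: "Ck_on 3 h C" "\<forall>x\<in>C. H x = hessian h x" for h y
    unfolding One_nat_def
  proof (rule Ck_on_SucI[OF assms(2)])
    show "(bregman h y has_derivative (\<lambda>v. (H x *v v) \<bullet> (x - y))) (at x)" if "x \<in> C" for x
      using D[OF h that] by (simp add: gderiv_def sym_pos_def_inner[OF assms(5)[OF that]])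
    show "Ck_on 0 (\<lambda>x. (H x *v v) \<bullet> (x - y)) C" for v
      using bounded_linear.continuous_on[OF bounded_linear_matrix_vector_mult_left
          Ck_on_1_imp_continuous_on[OF assms(4)]]
      by (auto intro!: continuous_intros)
  qed
  show ?thesis
  proof (intro conjI iffI)
    assume "\<forall>y\<in>C. metric_gradient_field_on C H (\<lambda>x. x - y)"
    then obtain h g where "\<And>x. x \<in> C \<Longrightarrow> GDERIV h x :> g x"
        and "\<And>x. x \<in> C \<Longrightarrow> (g has_derivative (*v) (H x)) (at x)"
      using gradient_fields_imp_potential[of C H] assms(1,2,5) by blast
    then show "\<exists>h. strictly_convex_on C h \<and> Ck_on 3 h C \<and> (\<forall>x\<in>C. H x = hessian h x)"
      using potential_imp_hessian[OF assms(2-5)] by blast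
  next
    assume "\<exists>h. strictly_convex_on C h \<and> Ck_on 3 h C \<and> (\<forall>x\<in>C. H x = hessian h x)"
    then obtain h where h: "Ck_on 3 h C" "\<forall>x\<in>C. H x = hessian h x"
      by blast
    \<comment> \<open>The potential of the field for \<open>y\<close> is
      \<open>bregman h y\<close>.\<close>
    then show "\<forall>y\<in>C. metric_gradient_field_on C H (\<lambda>x. x - y)"
      unfolding metric_gradient_field_on_def by (metis C1 grad)
  qed (use grad in auto)
qed

end
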